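(* Let $K$ be an irreducible Markov kernel on a finite state space $\mathcal{X}$ with $|\mathcal X|\ge 2$, with invariant probability measure $\pi$, and let $H_t=e^{-t(I-K)}$ be the associated continuous-time chain. For every $\epsilon>0$, the $L^\infty$ mixing time $\tau_\infty(\epsilon)$ of $H_t$ satisfies $$\tau_{\infty}(\epsilon) \leq \int_{4\pi_*}^{4/\epsilon} \frac{4\,dv}{v\, \Phi_*^2(v)}.$$
   Context: $K$ is not assumed reversible. $\pi$ is the unique invariant probability measure of $K$, and $\pi_*=\min_x\pi(x)>0$. $H_t(x,y)=e^{-t}\sum_{n\ge0}\frac{t^n}{n!}K^n(x,y)$. The $L^\infty$ mixing time is $$\tau_\infty(\epsilon)=\inf\Big\{t>0:\ \sup_{x,y\in\mathcal X}\Big|\frac{H_t(x,y)-\pi(y)}{\pi(y)}\Big|\le\epsilon\Big\}.$$ Put $Q(A,B)=\sum_{x\in A,\,y\in B}\pi(x)K(x,y)$ and $|\partial S|=Q(S,S^c)$. The conductance profile is $\Phi(r)=\inf_{\pi_*\le\pi(S)\le r}\frac{|\partial S|}{\pi(S)}$ for $r\in[\pi_*,1)$. The truncated conductance profile is $\Phi_*(r)=\Phi(r)$ for $\pi_*\le r<1/2$ and $\Phi_*(r)=\Phi(1/2)$ for all $r\ge1/2$. The integral is read as $0$ when $4/\epsilon<4\pi_*$. *)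

theory Defs
  imports "HOL-Analysis.Analysis"
begin

text \<open>
  The state space is the universe of a type of class \<open>finite\<close>; a kernel is its transition
  matrix \<open>K :: 'a \<Rightarrow> 'a \<Rightarrow> real\<close>, and a measure is its mass function \<open>\<pi> :: 'a \<Rightarrow> real\<close>.
\<close>

definition markov_kernel :: "('a::finite \<Rightarrow> 'a \<Rightarrow> real) \<Rightarrow> bool" where
  "markov_kernel K \<longleftrightarrow> (\<forall>x y. 0 \<le> K x y) \<and> (\<forall>x. (\<Sum>y\<in>UNIV. K x y) = 1)"

fun kernel_pow :: "('a::finite \<Rightarrow> 'a \<Rightarrow> real) \<Rightarrow> nat \<Rightarrow> 'a \<Rightarrow> 'a \<Rightarrow> real" where
  "kernel_pow K 0 x y = (if x = y then 1 else 0)"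
| "kernel_pow K (Suc n) x y = (\<Sum>z\<in>UNIV. K x z * kernel_pow K n z y)"

definition irreducible_kernel :: "('a::finite \<Rightarrow> 'a \<Rightarrow> real) \<Rightarrow> bool" where
  "irreducible_kernel K \<longleftrightarrow> (\<forall>x y. \<exists>n. kernel_pow K n x y > 0)"

definition prob_mass :: "('a::finite \<Rightarrow> real) \<Rightarrow> bool" where
  "prob_mass \<pi> \<longleftrightarrow> (\<forall>x. 0 \<le> \<pi> x) \<and> (\<Sum>x\<in>UNIV. \<pi> x) = 1"

definition invariant :: "('a::finite \<Rightarrow> 'a \<Rightarrow> real) \<Rightarrow> ('a \<Rightarrow> real) \<Rightarrow> bool" where
  "invariant K \<pi> \<longleftrightarrow> (\<forall>y. (\<Sum>x\<in>UNIV. \<pi> x * K x y) = \<pi> y)"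

definition heat_kernel :: "('a::finite \<Rightarrow> 'a \<Rightarrow> real) \<Rightarrow> real \<Rightarrow> 'a \<Rightarrow> 'a \<Rightarrow> real" where
  "heat_kernel K t x y = exp (- t) * (\<Sum>n. t ^ n / fact n * kernel_pow K n x y)"

text \<open>The infimum is taken in \<open>ereal\<close>, so that it would be \<open>\<infinity>\<close> if no time \<open>t\<close> qualified.\<close>

definition mixing_time_Linf ::
    "('a::finite \<Rightarrow> 'a \<Rightarrow> real) \<Rightarrow> ('a \<Rightarrow> real) \<Rightarrow> real \<Rightarrow> ereal" where
  "mixing_time_Linf K \<pi> \<epsilon> =
     Inf (ereal ` {t. t > 0 \<and>
       (SUP (x, y) \<in> UNIV. \<bar>(heat_kernel K t x y - \<pi> y) / \<pi> y\<bar>) \<le> \<epsilon>})"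

definition min_mass :: "('a::finite \<Rightarrow> real) \<Rightarrow> real" where
  "min_mass \<pi> = Min (range \<pi>)"

definition flow ::
    "('a::finite \<Rightarrow> 'a \<Rightarrow> real) \<Rightarrow> ('a \<Rightarrow> real) \<Rightarrow> 'a set \<Rightarrow> 'a set \<Rightarrow> real" where
  "flow K \<pi> A B = (\<Sum>x\<in>A. \<Sum>y\<in>B. \<pi> x * K x y)"

definition boundary_size ::
    "('a::finite \<Rightarrow> 'a \<Rightarrow> real) \<Rightarrow> ('a \<Rightarrow> real) \<Rightarrow> 'a set \<Rightarrow> real" where
  "boundary_size K \<pi> S = flow K \<pi> S (- S)"

text \<open>Only meaningful for \<open>r \<ge> min_mass \<pi>\<close>; otherwise the infimum is over the empty set.\<close>

definition conductance_profile ::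
    "('a::finite \<Rightarrow> 'a \<Rightarrow> real) \<Rightarrow> ('a \<Rightarrow> real) \<Rightarrow> real \<Rightarrow> real" where
  "conductance_profile K \<pi> r =
     (INF S \<in> {S. min_mass \<pi> \<le> sum \<pi> S \<and> sum \<pi> S \<le> r}. boundary_size K \<pi> S / sum \<pi> S)"

definition trunc_conductance_profile ::
    "('a::finite \<Rightarrow> 'a \<Rightarrow> real) \<Rightarrow> ('a \<Rightarrow> real) \<Rightarrow> real \<Rightarrow> real" where
  "trunc_conductance_profile K \<pi> r =
     (if r < 1 / 2 then conductance_profile K \<pi> r else conductance_profile K \<pi> (1 / 2))"

end

theory Submission
  imports Defs
begin

text \<open>
  For a density \<open>u\<close> with respect to \<open>\<pi>\<close> that evolves under the chain, the variance \<open>I\<close> satisfies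
  \<open>I' = - 2 * \<E>(u)\<close>, where \<open>\<E>\<close> is the Dirichlet form. A Faber-Krahn argument bounds \<open>\<E>(u)\<close> from
  below in terms of \<open>I\<close> alone. Since \<open>u\<close> has mean 1 and variance \<open>I\<close>, cutting it at the level
  \<open>I / 4\<close> keeps at least half of the variance, while by Markov's inequality what is left lives on
  a set of mass at most \<open>4 / I\<close>. On functions with small support the Dirichlet form dominates the
  variance with constant \<open>\<Phi>\<^sub>*\<^sup>2 / 2\<close> (Cheeger's inequality for small sets, with a split at a median
  for large ones), and therefore \<open>\<E>(u) \<ge> \<Phi>\<^sub>*(4 / I)\<^sup>2 / 4 * I\<close> (\<open>dirichlet_form_ge_profile\<close>).

  The substitution \<open>v = 4 / I\<close> turns this differential inequality into
  \<open>v' \<ge> v * \<Phi>\<^sub>*(v)\<^sup>2 / 2\<close>. At time 0 the density is a point mass, so that \<open>I < 1 / \<pi>\<^sub>*\<close> and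
  \<open>v > 4 * \<pi>\<^sub>*\<close>; hence \<open>v\<close> has reached \<open>4 / \<epsilon>\<close>, that is \<open>I \<le> \<epsilon>\<close>, by the time
  \<open>T = \<integral> 2 / (v * \<Phi>\<^sub>*(v)\<^sup>2) dv\<close> taken from \<open>4 * \<pi>\<^sub>*\<close> to \<open>4 / \<epsilon>\<close> (\<open>variance_decay\<close>).

  Twice this time gives the supremum bound. By the semigroup property,
  \<open>H\<^sub>2\<^sub>T(x,y) / \<pi>(y)\<close> is the \<open>\<pi>\<close>-average over \<open>z\<close> of \<open>H\<^sub>T(x,z) / \<pi>(z)\<close> times \<open>H\<^sub>T(z,y) / \<pi>(y)\<close>. The
  first factor evolves under the time reversal of the chain and the second under the chain itself.
  Both generators have the same quadratic form, so \<open>variance_decay\<close> applies to both factors, also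
  without reversibility; as both have mean 1, the deviation of the average from 1 is at most the
  mean of the two variances (\<open>heat_kernel_density_bound\<close>).

  If \<open>\<epsilon> \<ge> 1 / \<pi>\<^sub>*\<close> the integral is 0, and every positive time already satisfies the bound.
\<close>

section \<open>A comparison principle for differential inequalities\<close>

text \<open>
  The second mean value theorem covers a monotone factor without any continuity, which matters
  because the conductance profile is a step function.
\<close>

lemma integrable_inverse_times_antimono:
  fixes w :: "real \<Rightarrow> real"
  assumes "0 < c" "c \<le> a"
    and pos: "\<And>v. c \<le> v \<Longrightarrow> 0 < w v"
    and anti: "\<And>u v. c \<le> u \<Longrightarrow> u \<le> v \<Longrightarrow> w v \<le> w u"
  shows "(\<lambda>v. 1 / (v * w v)) integrable_on {a..b}"
proof (cases "a \<le> b")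
  case True
  have cont: "continuous_on {a..b} (\<lambda>v::real. 1 / v)"
    using assms(1,2) by (intro continuous_intros) auto
  have mono: "1 / w x \<le> 1 / w y" if "a \<le> x" "x \<le> y" "y \<le> b" for x y
    using anti[of x y] pos[of x] pos[of y] that assms(2) by (intro divide_left_mono) auto
  obtain d where "((\<lambda>v. 1 / w v * (1 / v)) has_integral
      (1 / w a * integral {a..d} (\<lambda>v. 1 / v) + 1 / w b * integral {d..b} (\<lambda>v. 1 / v))) {a..b}"
    using second_mean_value_theorem_full
      [OF integrable_continuous_real[OF cont] True, of "\<lambda>v. 1 / w v"] mono by metis
  then have "(\<lambda>v. 1 / w v * (1 / v)) integrable_on {a..b}"
    by blast
  then show ?thesis by (simp add: mult.commute)
qed auto

text \<open>
  If \<open>w\<close> were continuous, \<open>F v = \<integral> 1 / (v * w v) dv\<close> would be differentiable and \<open>(F \<circ> J)' \<ge> 1\<close>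
  would end the proof. For a merely antimonotone \<open>w\<close>, the estimate on a short interval \<open>{a..b}\<close> is
  \<open>F (J b) - F (J a) \<ge> (b - a) * w (J b) / w (J a)\<close>: on it \<open>ln \<circ> J\<close> grows at rate at least
  \<open>w (J b)\<close>, and \<open>1 / w\<close> is at least \<open>1 / w (J a)\<close>. The quotient is at least
  \<open>1 + ln (w (J b)) - ln (w (J a))\<close>, and over a partition of \<open>{0..T}\<close> into \<open>n\<close> equal parts these
  errors telescope to \<open>T / n\<close> times a constant, which vanishes as \<open>n \<longlonglongrightarrow> \<infinity>\<close>.
\<close>

lemma log_growth_comparison:
  fixes J J' w :: "real \<Rightarrow> real"
  assumes "0 \<le> T" and "0 < c"
    and pos: "\<And>v. c \<le> v \<Longrightarrow> 0 < w v"
    and anti: "\<And>u v. c \<le> u \<Longrightarrow> u \<le> v \<Longrightarrow> w v \<le> w u"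
    and ge: "\<And>t. 0 \<le> t \<Longrightarrow> t \<le> T \<Longrightarrow> c \<le> J t"
    and deriv: "\<And>t. 0 \<le> t \<Longrightarrow> t \<le> T \<Longrightarrow> (J has_real_derivative J' t) (at t)"
    and growth: "\<And>t. 0 \<le> t \<Longrightarrow> t \<le> T \<Longrightarrow> J t * w (J t) \<le> J' t"
  shows "T \<le> integral {J 0..J T} (\<lambda>v. 1 / (v * w v))"
proof -
  let ?g = "\<lambda>v. 1 / (v * w v)"
  have int: "?g integrable_on {a..b}" if "c \<le> a" for a b
    using integrable_inverse_times_antimono[OF \<open>0 < c\<close> that pos anti] .
  have pos_deriv: "0 \<le> J' t" if "0 \<le> t" "t \<le> T" for t
  proof -
    have "0 \<le> J t * w (J t)" using ge[OF that] pos[OF ge[OF that]] \<open>0 < c\<close> by simp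
    with growth[OF that] show ?thesis by linarith
  qed
  have mono: "J a \<le> J b" if "0 \<le> a" "a \<le> b" "b \<le> T" for a b
    using that by (intro DERIV_nonneg_imp_nondecreasing[of a b J]) (auto intro!: exI deriv pos_deriv)
  have step: "(b - a) * (1 + ln (w (J b)) - ln (w (J a))) \<le> integral {J a..J b} ?g"
    if ab: "0 \<le> a" "a \<le> b" "b \<le> T" for a b
  proof -
    have Ja: "c \<le> J a" "0 < J a" and Jab: "J a \<le> J b"
      using ge[of a] ab mono[OF ab] \<open>0 < c\<close> by auto
    then have wa: "0 < w (J a)" and wb: "0 < w (J b)" using pos by auto
    have log_bound: "w (J b) * (b - a) \<le> ln (J b) - ln (J a)"
    proof -
      have "(\<lambda>t. ln (J t) - w (J b) * t) a \<le> (\<lambda>t. ln (J t) - w (J b) * t) b"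
      proof (rule DERIV_nonneg_imp_nondecreasing[OF ab(2)])
        fix t assume "a \<le> t" "t \<le> b"
        then have t: "0 \<le> t" "t \<le> T" "t \<le> b" using ab by auto
        then have Jt: "0 < J t" using ge[of t] \<open>0 < c\<close> by auto
        have "w (J b) \<le> w (J t)" using anti[OF ge mono] t ab by auto
        also have "w (J t) \<le> J' t / J t"
          using growth[of t] t Jt by (simp add: field_simps)
        finally have "0 \<le> J' t / J t - w (J b)" by simp
        moreover have "((\<lambda>t. ln (J t) - w (J b) * t) has_real_derivative J' t / J t - w (J b)) (at t)"
          using deriv[of t] t Jt by (auto intro!: derivative_eq_intros)
        ultimately show "\<exists>y. ((\<lambda>t. ln (J t) - w (J b) * t) has_real_derivative y) (at t) \<and> 0 \<le> y"
          by blast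
      qed
      then show ?thesis by (simp add: algebra_simps)
    qed
    have "1 + ln (w (J b)) - ln (w (J a)) \<le> w (J b) / w (J a)"
      using ln_le_minus_one[of "w (J b) / w (J a)"] wa wb by (simp add: ln_div)
    then have "(b - a) * (1 + ln (w (J b)) - ln (w (J a))) \<le> (b - a) * (w (J b) / w (J a))"
      using ab by (intro mult_left_mono) auto
    also have "\<dots> = 1 / w (J a) * (w (J b) * (b - a))" by simp
    also have "\<dots> \<le> 1 / w (J a) * (ln (J b) - ln (J a))"
      using log_bound wa by (intro mult_left_mono) auto
    also have "\<dots> \<le> integral {J a..J b} ?g"
    proof (rule has_integral_le)
      have "((\<lambda>v. 1 / v) has_integral (ln (J b) - ln (J a))) {J a..J b}"
        using Ja Jab
        by (intro fundamental_theorem_of_calculus)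
           (auto intro!: derivative_eq_intros
             simp: has_real_derivative_iff_has_vector_derivative[symmetric])
      from has_integral_mult_right[OF this, of "1 / w (J a)"]
      show "((\<lambda>v. 1 / w (J a) * (1 / v)) has_integral 1 / w (J a) * (ln (J b) - ln (J a))) {J a..J b}" .
      show "(?g has_integral integral {J a..J b} ?g) {J a..J b}"
        using int Ja by (intro integrable_integral) auto
      show "1 / w (J a) * (1 / v) \<le> ?g v" if "v \<in> {J a..J b}" for v
        using that anti[of "J a" v] pos[of v] Ja by (auto simp: field_simps)
    qed
    finally show ?thesis .
  qed
  have partition: "T + T / n * (ln (w (J T)) - ln (w (J 0))) \<le> integral {J 0..J T} ?g"
    if "0 < n" for n :: nat
  proof -
    define t where "t i = real i * T / n" for i
    have t_le: "t i \<le> T" if "i \<le> n" for i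
      using mult_left_mono[of "real i" "real n" T] that \<open>0 < n\<close> \<open>0 \<le> T\<close>
      by (simp add: t_def field_simps)
    have t_ge: "0 \<le> t i" for i using \<open>0 \<le> T\<close> by (simp add: t_def)
    have t_mono: "t i \<le> t (Suc i)" for i using \<open>0 \<le> T\<close> by (simp add: t_def divide_right_mono algebra_simps)
    have t_diff: "t (Suc i) - t i = T / n" for i
      by (simp add: t_def diff_divide_distrib[symmetric] algebra_simps)
    have "t k + T / n * (ln (w (J (t k))) - ln (w (J 0))) \<le> integral {J 0..J (t k)} ?g"
      if "k \<le> n" for k
      using that
    proof (induction k)
      case 0
      show ?case by (simp add: t_def)
    next
      case (Suc k)
      have "t (Suc k) + T / n * (ln (w (J (t (Suc k)))) - ln (w (J 0)))
          = (t k + T / n * (ln (w (J (t k))) - ln (w (J 0))))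
            + (t (Suc k) - t k) * (1 + ln (w (J (t (Suc k)))) - ln (w (J (t k))))"
        using t_diff[of k] by (simp add: algebra_simps)
      also have "\<dots> \<le> integral {J 0..J (t k)} ?g + integral {J (t k)..J (t (Suc k))} ?g"
        using Suc t_ge t_mono t_le by (intro add_mono step) auto
      also have "\<dots> = integral {J 0..J (t (Suc k))} ?g"
        using Suc t_ge t_mono[of k] t_le[of k] t_le[of "Suc k"] ge[of 0] \<open>0 \<le> T\<close>
        by (intro Henstock_Kurzweil_Integration.integral_combine mono int) auto
      finally show ?case .
    qed
    from this[of n] show ?thesis using \<open>0 < n\<close> by (simp add: t_def)
  qed
  have lim: "(\<lambda>n. T + T / real n * (ln (w (J T)) - ln (w (J 0)))) \<longlonglongrightarrow> T"
  proof -
    have "(\<lambda>n. T / real n) \<longlonglongrightarrow> 0" by (rule lim_const_over_n)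
    from tendsto_add[OF tendsto_const tendsto_mult_right[OF this], of T]
    show ?thesis by simp
  qed
  show ?thesis
    by (rule LIMSEQ_le_const2[OF lim]) (use partition in \<open>auto intro!: exI[of _ 1]\<close>)
qed

section \<open>Irreducible chains and their Dirichlet form\<close>

definition expect :: "('a::finite \<Rightarrow> real) \<Rightarrow> ('a \<Rightarrow> real) \<Rightarrow> real" where
  "expect \<pi> f = (\<Sum>x\<in>UNIV. \<pi> x * f x)"

text \<open>
  This is the quadratic form of \<open>I - K\<close> when \<open>\<pi>\<close> is invariant. It does not change when \<open>K\<close> is
  replaced by its time reversal \<open>\<pi> y * K y x / \<pi> x\<close>.
\<close>

definition dirichlet_form :: "('a::finite \<Rightarrow> 'a \<Rightarrow> real) \<Rightarrow> ('a \<Rightarrow> real) \<Rightarrow> ('a \<Rightarrow> real) \<Rightarrow> real" where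
  "dirichlet_form K \<pi> f = (\<Sum>x\<in>UNIV. \<Sum>y\<in>UNIV. \<pi> x * K x y * (f x - f y)\<^sup>2) / 2"

abbreviation second_moment :: "('a::finite \<Rightarrow> real) \<Rightarrow> ('a \<Rightarrow> real) \<Rightarrow> real" where
  "second_moment \<pi> f \<equiv> expect \<pi> (\<lambda>x. (f x)\<^sup>2)"

definition variance_of :: "('a::finite \<Rightarrow> real) \<Rightarrow> ('a \<Rightarrow> real) \<Rightarrow> real" where
  "variance_of \<pi> f = second_moment \<pi> f - (expect \<pi> f)\<^sup>2"

locale ergodic_chain =
  fixes K :: "'a::finite \<Rightarrow> 'a \<Rightarrow> real" and \<pi> :: "'a \<Rightarrow> real"
  assumes nontrivial: "CARD('a) \<ge> 2"
    and kernel: "markov_kernel K"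
    and irreducible: "irreducible_kernel K"
    and prob: "prob_mass \<pi>"
    and invariant: "invariant K \<pi>"
begin

abbreviation \<Phi> :: "real \<Rightarrow> real" where
  "\<Phi> \<equiv> conductance_profile K \<pi>"

abbreviation trunc_profile :: "real \<Rightarrow> real" (\<open>\<Phi>\<^sub>*\<close>) where
  "\<Phi>\<^sub>* \<equiv> trunc_conductance_profile K \<pi>"

lemma K_nonneg: "0 \<le> K x y"
  and K_row_sum: "(\<Sum>y\<in>UNIV. K x y) = 1"
  and mass_nonneg: "0 \<le> \<pi> x"
  and mass_total: "(\<Sum>x\<in>UNIV. \<pi> x) = 1"
  and mass_K: "(\<Sum>x\<in>UNIV. \<pi> x * K x y) = \<pi> y"
  using kernel prob invariant by (auto simp: markov_kernel_def prob_mass_def invariant_def)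

lemma kernel_pow_nonneg: "0 \<le> kernel_pow K n x y"
  by (induction n arbitrary: x) (auto intro!: sum_nonneg mult_nonneg_nonneg K_nonneg)

lemma kernel_pow_row_sum: "(\<Sum>y\<in>UNIV. kernel_pow K n x y) = 1"
proof (induction n arbitrary: x)
  case (Suc n)
  have "(\<Sum>y\<in>UNIV. kernel_pow K (Suc n) x y) = (\<Sum>z\<in>UNIV. K x z * (\<Sum>y\<in>UNIV. kernel_pow K n z y))"
    by (simp add: sum_distrib_left) (rule sum.swap)
  then show ?case by (simp add: Suc K_row_sum)
qed simp

lemma kernel_pow_le_1: "kernel_pow K n x y \<le> 1"
  using member_le_sum[of y UNIV "kernel_pow K n x"] kernel_pow_nonneg kernel_pow_row_sum[of n x] by simp

lemma mass_kernel_pow: "(\<Sum>x\<in>UNIV. \<pi> x * kernel_pow K n x y) = \<pi> y"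
proof (induction n)
  case (Suc n)
  have "(\<Sum>x\<in>UNIV. \<pi> x * kernel_pow K (Suc n) x y)
      = (\<Sum>z\<in>UNIV. (\<Sum>x\<in>UNIV. \<pi> x * K x z) * kernel_pow K n z y)"
    by (simp add: sum_distrib_left sum_distrib_right mult.assoc) (rule sum.swap)
  then show ?case by (simp add: Suc mass_K)
qed (simp add: sum.delta' if_distrib cong: if_cong)

lemma mass_pos: "0 < \<pi> y"
proof -
  obtain x where x: "0 < \<pi> x"
    using mass_total sum_nonpos[of UNIV \<pi>] by (metis not_less zero_less_one)
  obtain n where n: "0 < kernel_pow K n x y"
    using irreducible by (auto simp: irreducible_kernel_def)
  have "0 < \<pi> x * kernel_pow K n x y" using x n by simp
  also have "\<dots> \<le> (\<Sum>x\<in>UNIV. \<pi> x * kernel_pow K n x y)"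
    by (rule member_le_sum) (auto intro: mult_nonneg_nonneg mass_nonneg kernel_pow_nonneg)
  finally show ?thesis by (simp add: mass_kernel_pow)
qed

lemma min_mass_pos: "0 < min_mass \<pi>"
  by (simp add: min_mass_def mass_pos)

lemma min_mass_le: "min_mass \<pi> \<le> \<pi> x"
  by (simp add: min_mass_def)

lemma min_mass_le_sum: "S \<noteq> {} \<Longrightarrow> min_mass \<pi> \<le> sum \<pi> S"
  using member_le_sum[of _ S \<pi>] min_mass_le mass_nonneg by (meson all_not_in_conv finite order_trans)

lemma min_mass_le_half: "min_mass \<pi> \<le> 1 / 2"
proof -
  obtain x y :: 'a where "x \<noteq> y"
    using nontrivial by (metis (full_types) UNIV_I card_2_iff' card_le_Suc0_iff_eq finite not_less_eq_eq numeral_2_eq_2)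
  then have "\<pi> x + \<pi> y \<le> 1"
    using sum_mono2[of UNIV "{x, y}" \<pi>] mass_nonneg mass_total by simp
  then show ?thesis using min_mass_le[of x] min_mass_le[of y] by linarith
qed

lemma sum_edges_fst: "(\<Sum>x\<in>UNIV. \<Sum>y\<in>UNIV. \<pi> x * K x y * f x) = expect \<pi> f"
proof -
  have "(\<Sum>y\<in>UNIV. \<pi> x * K x y * f x) = \<pi> x * f x * (\<Sum>y\<in>UNIV. K x y)" for x
    by (simp add: sum_distrib_left mult_ac)
  then show ?thesis by (simp add: expect_def K_row_sum)
qed

lemma sum_edges_snd: "(\<Sum>x\<in>UNIV. \<Sum>y\<in>UNIV. \<pi> x * K x y * f y) = expect \<pi> f"
proof -
  have "(\<Sum>x\<in>UNIV. \<Sum>y\<in>UNIV. \<pi> x * K x y * f y) = (\<Sum>y\<in>UNIV. (\<Sum>x\<in>UNIV. \<pi> x * K x y) * f y)"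
    by (subst sum.swap) (simp add: sum_distrib_right)
  then show ?thesis by (simp add: mass_K expect_def)
qed

lemma dirichlet_form_eq:
  "dirichlet_form K \<pi> f = second_moment \<pi> f - (\<Sum>x\<in>UNIV. \<Sum>y\<in>UNIV. \<pi> x * K x y * (f x * f y))"
proof -
  have "(\<Sum>x\<in>UNIV. \<Sum>y\<in>UNIV. \<pi> x * K x y * (f x - f y)\<^sup>2)
      = (\<Sum>x\<in>UNIV. \<Sum>y\<in>UNIV. \<pi> x * K x y * (f x)\<^sup>2) + (\<Sum>x\<in>UNIV. \<Sum>y\<in>UNIV. \<pi> x * K x y * (f y)\<^sup>2)
        - 2 * (\<Sum>x\<in>UNIV. \<Sum>y\<in>UNIV. \<pi> x * K x y * (f x * f y))"
    by (simp add: sum_distrib_left sum.distrib[symmetric] sum_subtractf[symmetric])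
       (simp add: power2_eq_square algebra_simps)
  then show ?thesis
    unfolding dirichlet_form_def sum_edges_fst[of "\<lambda>x. (f x)\<^sup>2"] sum_edges_snd[of "\<lambda>x. (f x)\<^sup>2"] by simp
qed

lemma edge_sum_mono:
  assumes "\<And>x y. F x y \<le> G x y"
  shows "(\<Sum>x\<in>UNIV. \<Sum>y\<in>UNIV. \<pi> x * K x y * F x y) \<le> (\<Sum>x\<in>UNIV. \<Sum>y\<in>UNIV. \<pi> x * K x y * G x y)"
  by (intro sum_mono mult_left_mono assms mult_nonneg_nonneg mass_nonneg K_nonneg)

lemma dirichlet_form_nonneg: "0 \<le> dirichlet_form K \<pi> f"
  by (auto simp: dirichlet_form_def intro!: sum_nonneg mult_nonneg_nonneg mass_nonneg K_nonneg)

lemma expect_mono: "(\<And>x. f x \<le> g x) \<Longrightarrow> expect \<pi> f \<le> expect \<pi> g"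
  unfolding expect_def by (intro sum_mono mult_left_mono mass_nonneg)

lemma boundary_size_eq:
  "boundary_size K \<pi> S = (\<Sum>x\<in>UNIV. \<Sum>y\<in>UNIV. \<pi> x * K x y * of_bool (x \<in> S \<and> y \<notin> S))"
proof -
  have "(\<Sum>y\<in>UNIV. \<pi> x * K x y * of_bool (x \<in> S \<and> y \<notin> S))
      = (\<Sum>y\<in>- S. \<pi> x * K x y) * of_bool (x \<in> S)" for x
    by (cases "x \<in> S") (simp_all add: sum_mult_of_bool_eq Compl_eq)
  then show ?thesis
    by (simp add: boundary_size_def flow_def sum_mult_of_bool_eq)
qed

lemma boundary_size_nonneg: "0 \<le> boundary_size K \<pi> S"
  unfolding boundary_size_eq by (intro sum_nonneg mult_nonneg_nonneg mass_nonneg K_nonneg) auto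

text \<open>
  Without flow out of \<open>S\<close>, no power of \<open>K\<close> leads from \<open>S\<close> to its complement.
\<close>

lemma boundary_size_pos:
  assumes "S \<noteq> {}" "S \<noteq> UNIV"
  shows "0 < boundary_size K \<pi> S"
proof (rule ccontr)
  assume "\<not> 0 < boundary_size K \<pi> S"
  then have "boundary_size K \<pi> S = 0" using boundary_size_nonneg[of S] by linarith
  then have "\<forall>x\<in>S. \<forall>y\<in>- S. \<pi> x * K x y = 0"
    unfolding boundary_size_def flow_def
    by (subst (asm) sum_nonneg_eq_0_iff;
        simp add: sum_nonneg_eq_0_iff sum_nonneg mass_nonneg K_nonneg)
  then have closed: "K x y = 0" if "x \<in> S" "y \<notin> S" for x y
    using that mass_pos[of x] by auto
  have "kernel_pow K n x y = 0" if "x \<in> S" "y \<notin> S" for n x y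
    using that
  proof (induction n arbitrary: x)
    case (Suc n)
    have "K x z * kernel_pow K n z y = 0" for z
      using closed[of x z] Suc by (cases "z \<in> S") auto
    then show ?case unfolding kernel_pow.simps by (intro sum.neutral ballI)
  qed auto
  moreover obtain x y where "x \<in> S" "y \<notin> S" using assms by blast
  ultimately show False
    using irreducible by (metis irreducible_kernel_def less_irrefl)
qed

section \<open>The Cheeger inequality\<close>

text \<open>
  A discrete coarea argument, by induction on the size of the support: subtracting from \<open>h\<close> its
  least positive value \<open>m\<close> on the support \<open>S\<close> shrinks the support. This lowers the left side by
  \<open>m * \<phi>\<close> times the mass of \<open>S\<close>, and the right side by \<open>m\<close> times the boundary of \<open>S\<close>, because
  only on the edges that leave \<open>S\<close> does the difference of the values change. The isoperimetric
  hypothesis for \<open>S\<close> compares the two.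
\<close>

lemma layered_isoperimetry:
  assumes "\<And>x. 0 \<le> h x"
    and "\<And>S. S \<noteq> {} \<Longrightarrow> S \<subseteq> {x. 0 < h x} \<Longrightarrow> \<phi> * sum \<pi> S \<le> boundary_size K \<pi> S"
  shows "\<phi> * expect \<pi> h \<le> (\<Sum>x\<in>UNIV. \<Sum>y\<in>UNIV. \<pi> x * K x y * max 0 (h x - h y))"
  using assms
proof (induction "card {x. 0 < h x}" arbitrary: h rule: less_induct)
  case less
  define S where "S = {x. 0 < h x}"
  show ?case
  proof (cases "S = {}")
    case True
    then have "h x = 0" for x
      using less.prems(1)[of x] unfolding S_def set_eq_iff by (simp add: order.eq_iff not_less)
    then show ?thesis by (simp add: expect_def)
  next
    case False
    define m where "m = Min (h ` S)"
    define h' where "h' x = h x - m * of_bool (x \<in> S)" for x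
    have m_le: "m \<le> h x" if "x \<in> S" for x using that by (simp add: m_def)
    have "m \<in> h ` S" unfolding m_def using False by (intro Min_in) auto
    then obtain a where a: "a \<in> S" "h a = m" by auto
    then have m_pos: "0 < m" by (auto simp: S_def)
    have outside: "h x = 0" if "x \<notin> S" for x using that less.prems(1)[of x] by (auto simp: S_def)
    have h'_nonneg: "0 \<le> h' x" for x
      using m_le[of x] outside[of x] by (cases "x \<in> S") (auto simp: h'_def)
    have subset: "{x. 0 < h' x} \<subseteq> S - {a}"
    proof
      fix x assume "x \<in> {x. 0 < h' x}"
      then have x: "0 < h' x" by simp
      have "h' a = 0" using a by (simp add: h'_def)
      moreover have "h' x = 0" if "x \<notin> S" using that outside by (simp add: h'_def)
      ultimately show "x \<in> S - {a}" using x by auto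
    qed
    then have "card {x. 0 < h' x} < card S"
      using a by (intro psubset_card_mono) auto
    then have IH: "\<phi> * expect \<pi> h' \<le> (\<Sum>x\<in>UNIV. \<Sum>y\<in>UNIV. \<pi> x * K x y * max 0 (h' x - h' y))"
      using h'_nonneg subset unfolding S_def by (intro less.hyps less.prems(2)) auto
    have max_eq: "max 0 (h x - h y) = max 0 (h' x - h' y) + m * of_bool (x \<in> S \<and> y \<notin> S)" for x y
      using outside[of x] outside[of y] m_le[of x] h'_nonneg[of x] h'_nonneg[of y] m_pos
      by (cases "x \<in> S"; cases "y \<in> S") (auto simp: h'_def)
    have "expect \<pi> h = expect \<pi> h' + m * sum \<pi> S"
    proof -
      have "expect \<pi> h = expect \<pi> h' + m * (\<Sum>x\<in>UNIV. \<pi> x * of_bool (x \<in> S))"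
        unfolding expect_def h'_def sum_distrib_left sum.distrib[symmetric] by (simp add: algebra_simps)
      then show ?thesis by (simp add: sum_mult_of_bool_eq)
    qed
    then have "\<phi> * expect \<pi> h = \<phi> * expect \<pi> h' + m * (\<phi> * sum \<pi> S)"
      by (simp add: algebra_simps)
    also have "\<dots> \<le> (\<Sum>x\<in>UNIV. \<Sum>y\<in>UNIV. \<pi> x * K x y * max 0 (h' x - h' y)) + m * boundary_size K \<pi> S"
      using IH less.prems(2)[of S] False m_pos
      by (intro add_mono mult_left_mono) (auto simp: S_def)
    also have "\<dots> = (\<Sum>x\<in>UNIV. \<Sum>y\<in>UNIV. \<pi> x * K x y * max 0 (h x - h y))"
      unfolding boundary_size_eq max_eq
      by (simp add: sum_distrib_left sum.distrib[symmetric] algebra_simps)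
    finally show ?thesis .
  qed
qed

text \<open>
  Apply the coarea bound to \<open>g\<^sup>2\<close>. The usual step from differences of squares to squares of
  differences uses the Cauchy-Schwarz inequality; the weighted arithmetic-geometric mean inequality
  with weight \<open>\<phi>\<close> yields the same constant edge by edge. The positive part of a difference is half
  the absolute value plus half the difference itself, and the latter sums to 0 over the edges
  because \<open>\<pi>\<close> is invariant.
\<close>

lemma cheeger_inequality:
  assumes g: "\<And>x. 0 \<le> g x"
    and iso: "\<And>S. S \<noteq> {} \<Longrightarrow> S \<subseteq> {x. 0 < g x} \<Longrightarrow> \<phi> * sum \<pi> S \<le> boundary_size K \<pi> S"
    and "0 \<le> \<phi>"
  shows "\<phi>\<^sup>2 / 2 * second_moment \<pi> g \<le> dirichlet_form K \<pi> g"
proof -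
  have layers: "\<phi> * second_moment \<pi> g \<le> (\<Sum>x\<in>UNIV. \<Sum>y\<in>UNIV. \<pi> x * K x y * max 0 ((g x)\<^sup>2 - (g y)\<^sup>2))"
    using iso g by (intro layered_isoperimetry) (auto simp: less_le)
  have pointwise: "\<phi> * (2 * max 0 (a\<^sup>2 - b\<^sup>2))
      \<le> (a - b)\<^sup>2 + \<phi> * (a\<^sup>2 - b\<^sup>2) + \<phi>\<^sup>2 / 2 * (a\<^sup>2 + b\<^sup>2)" for a b :: real
  proof -
    \<comment> \<open>The two signs \<open>s = 1\<close> and \<open>s = - 1\<close> together bound the absolute value.\<close>
    have "s * \<phi> * (a\<^sup>2 - b\<^sup>2) \<le> (a - b)\<^sup>2 + \<phi>\<^sup>2 / 2 * (a\<^sup>2 + b\<^sup>2)" if "s * s = 1" for s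
    proof -
      have "(a - b - s * \<phi> / 2 * (a + b))\<^sup>2
          = (a - b)\<^sup>2 - s * \<phi> * (a\<^sup>2 - b\<^sup>2) + (s * s) * (\<phi> / 2 * (a + b))\<^sup>2"
        by (simp add: power2_eq_square algebra_simps)
      then have "(a - b)\<^sup>2 + \<phi>\<^sup>2 / 2 * (a\<^sup>2 + b\<^sup>2) - s * \<phi> * (a\<^sup>2 - b\<^sup>2)
          = (a - b - s * \<phi> / 2 * (a + b))\<^sup>2 + (\<phi> / 2 * (a - b))\<^sup>2"
        using that by (simp add: power2_eq_square field_simps)
      also have "\<dots> \<ge> 0" by simp
      finally show ?thesis by simp
    qed
    from this[of 1] this[of "- 1"]
    have "\<bar>\<phi> * (a\<^sup>2 - b\<^sup>2)\<bar> \<le> (a - b)\<^sup>2 + \<phi>\<^sup>2 / 2 * (a\<^sup>2 + b\<^sup>2)"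
      by (simp add: abs_le_iff)
    moreover have "\<phi> * (2 * max 0 (a\<^sup>2 - b\<^sup>2)) = \<bar>\<phi> * (a\<^sup>2 - b\<^sup>2)\<bar> + \<phi> * (a\<^sup>2 - b\<^sup>2)"
    proof -
      have "2 * max 0 s = \<bar>s\<bar> + s" for s :: real by (simp add: max_def)
      then show ?thesis using \<open>0 \<le> \<phi>\<close> by (simp only: abs_mult distrib_left)
    qed
    ultimately show ?thesis by linarith
  qed
  have "2 * \<phi> * (\<phi> * second_moment \<pi> g)
      \<le> 2 * \<phi> * (\<Sum>x\<in>UNIV. \<Sum>y\<in>UNIV. \<pi> x * K x y * max 0 ((g x)\<^sup>2 - (g y)\<^sup>2))"
    using layers \<open>0 \<le> \<phi>\<close> by (intro mult_left_mono) auto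
  also have "\<dots> = (\<Sum>x\<in>UNIV. \<Sum>y\<in>UNIV. \<pi> x * K x y * (\<phi> * (2 * max 0 ((g x)\<^sup>2 - (g y)\<^sup>2))))"
    by (simp add: sum_distrib_left mult_ac)
  also have "\<dots> \<le> (\<Sum>x\<in>UNIV. \<Sum>y\<in>UNIV. \<pi> x * K x y *
      ((g x - g y)\<^sup>2 + \<phi> * ((g x)\<^sup>2 - (g y)\<^sup>2) + \<phi>\<^sup>2 / 2 * ((g x)\<^sup>2 + (g y)\<^sup>2)))"
    by (intro edge_sum_mono pointwise)
  also have "\<dots> = (\<Sum>x\<in>UNIV. \<Sum>y\<in>UNIV. \<pi> x * K x y * (g x - g y)\<^sup>2)
      + (\<phi> + \<phi>\<^sup>2 / 2) * (\<Sum>x\<in>UNIV. \<Sum>y\<in>UNIV. \<pi> x * K x y * (g x)\<^sup>2)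
      + (\<phi>\<^sup>2 / 2 - \<phi>) * (\<Sum>x\<in>UNIV. \<Sum>y\<in>UNIV. \<pi> x * K x y * (g y)\<^sup>2)"
    by (simp add: sum_distrib_left sum.distrib[symmetric]) (simp add: algebra_simps add_divide_distrib)
  also have "\<dots> = 2 * dirichlet_form K \<pi> g + \<phi>\<^sup>2 * second_moment \<pi> g"
    unfolding sum_edges_fst[of "\<lambda>x. (g x)\<^sup>2"] sum_edges_snd[of "\<lambda>x. (g x)\<^sup>2"]
    by (simp add: dirichlet_form_def algebra_simps)
  finally show ?thesis by (simp add: power2_eq_square algebra_simps)
qed

section \<open>The conductance profile\<close>

lemma conductance_profile_le:
  assumes "S \<noteq> {}" "sum \<pi> S \<le> r"
  shows "\<Phi> r * sum \<pi> S \<le> boundary_size K \<pi> S"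
proof -
  have "\<Phi> r \<le> boundary_size K \<pi> S / sum \<pi> S"
    unfolding conductance_profile_def
    using assms min_mass_le_sum[of S] by (intro cINF_lower bdd_below_finite) auto
  moreover have "0 < sum \<pi> S" using min_mass_pos min_mass_le_sum[OF assms(1)] by linarith
  ultimately show ?thesis by (simp add: field_simps)
qed

lemma exists_minimal_state: "\<exists>x. sum \<pi> {x} = min_mass \<pi>"
proof -
  have "min_mass \<pi> \<in> range \<pi>" unfolding min_mass_def by (intro Min_in) auto
  then show ?thesis by auto
qed

lemma conductance_profile_antimono:
  assumes "min_mass \<pi> \<le> r" "r \<le> s"
  shows "\<Phi> s \<le> \<Phi> r"
  unfolding conductance_profile_def
proof (rule cINF_superset_mono)
  obtain x where "sum \<pi> {x} = min_mass \<pi>" using exists_minimal_state by blast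
  then have "{x} \<in> {S. min_mass \<pi> \<le> sum \<pi> S \<and> sum \<pi> S \<le> r}" using assms by simp
  then show "{S. min_mass \<pi> \<le> sum \<pi> S \<and> sum \<pi> S \<le> r} \<noteq> {}" by blast
qed (use assms in \<open>auto intro!: bdd_below_finite\<close>)

lemma conductance_profile_pos:
  assumes "min_mass \<pi> \<le> r" "r < 1"
  shows "0 < \<Phi> r"
proof -
  let ?A = "{S. min_mass \<pi> \<le> sum \<pi> S \<and> sum \<pi> S \<le> r}"
  let ?q = "\<lambda>S. boundary_size K \<pi> S / sum \<pi> S"
  obtain x where "sum \<pi> {x} = min_mass \<pi>" using exists_minimal_state by blast
  then have "{x} \<in> ?A" using assms by simp
  then have "?A \<noteq> {}" by blast
  then have "Inf (?q ` ?A) \<in> ?q ` ?A"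
    using Min_in[of "?q ` ?A"] cInf_eq_Min[of "?q ` ?A"] by simp
  then obtain S where S: "S \<in> ?A" "\<Phi> r = ?q S"
    unfolding conductance_profile_def by (auto simp only: image_iff)
  then have "0 < sum \<pi> S" using min_mass_pos by (auto intro: less_le_trans)
  moreover from this have "S \<noteq> {}" by auto
  moreover have "S \<noteq> UNIV" using S(1) assms(2) mass_total by auto
  ultimately show ?thesis using S(2) boundary_size_pos[of S] by simp
qed

lemma trunc_profile_pos:
  assumes "min_mass \<pi> \<le> r"
  shows "0 < \<Phi>\<^sub>* r"
  using assms conductance_profile_pos[of r] conductance_profile_pos[of "1 / 2"] min_mass_le_half
  by (auto simp: trunc_conductance_profile_def)

lemma trunc_profile_antimono:
  assumes "min_mass \<pi> \<le> r" "r \<le> s"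
  shows "\<Phi>\<^sub>* s \<le> \<Phi>\<^sub>* r"
  using assms conductance_profile_antimono[of r s] conductance_profile_antimono[of r "1 / 2"]
  by (auto simp: trunc_conductance_profile_def)

section \<open>The Faber-Krahn inequality\<close>

lemma dirichlet_form_contraction:
  assumes "\<And>x y. \<bar>g x - g y\<bar> \<le> \<bar>f x - f y\<bar>"
  shows "dirichlet_form K \<pi> g \<le> dirichlet_form K \<pi> f"
  unfolding dirichlet_form_def using assms
  by (intro divide_right_mono edge_sum_mono) (auto simp: abs_le_square_iff)

text \<open>
  Since \<open>f - c\<close> is the difference of its positive and negative parts, and the increments of these
  along an edge have opposite signs, the cross term in \<open>(f x - f y)\<^sup>2\<close> is nonnegative.
\<close>

lemma dirichlet_form_split:
  "dirichlet_form K \<pi> (\<lambda>x. max 0 (f x - c)) + dirichlet_form K \<pi> (\<lambda>x. max 0 (c - f x))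
    \<le> dirichlet_form K \<pi> f"
proof -
  have pointwise: "(max 0 (a - c) - max 0 (b - c))\<^sup>2 + (max 0 (c - a) - max 0 (c - b))\<^sup>2 \<le> (a - b)\<^sup>2"
    for a b
  proof -
    define p q p' q' where pq: "p = max 0 (a - c)" "q = max 0 (b - c)" "p' = max 0 (c - a)" "q' = max 0 (c - b)"
    have "a - b = (p - q) - (p' - q')" by (auto simp: pq max_def)
    then have "(a - b)\<^sup>2 = (p - q)\<^sup>2 + (p' - q')\<^sup>2 - 2 * ((p - q) * (p' - q'))"
      by (simp only:) (simp add: power2_eq_square algebra_simps)
    moreover have "(p - q) * (p' - q') \<le> 0" by (auto simp: pq max_def mult_le_0_iff)
    ultimately show ?thesis unfolding pq[symmetric] by linarith
  qed
  have "(\<Sum>x\<in>UNIV. \<Sum>y\<in>UNIV. \<pi> x * K x y * (max 0 (f x - c) - max 0 (f y - c))\<^sup>2)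
      + (\<Sum>x\<in>UNIV. \<Sum>y\<in>UNIV. \<pi> x * K x y * (max 0 (c - f x) - max 0 (c - f y))\<^sup>2)
    = (\<Sum>x\<in>UNIV. \<Sum>y\<in>UNIV. \<pi> x * K x y * ((max 0 (f x - c) - max 0 (f y - c))\<^sup>2
        + (max 0 (c - f x) - max 0 (c - f y))\<^sup>2))"
    by (simp add: sum.distrib[symmetric] distrib_left)
  also have "\<dots> \<le> (\<Sum>x\<in>UNIV. \<Sum>y\<in>UNIV. \<pi> x * K x y * (f x - f y)\<^sup>2)"
    by (intro edge_sum_mono pointwise)
  finally show ?thesis by (simp add: dirichlet_form_def)
qed

lemma expect_add: "expect \<pi> (\<lambda>x. f x + g x) = expect \<pi> f + expect \<pi> g"
  by (simp add: expect_def distrib_left sum.distrib)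

lemma expect_cmult: "expect \<pi> (\<lambda>x. c * f x) = c * expect \<pi> f"
  by (simp add: expect_def sum_distrib_left mult_ac)

lemma expect_const: "expect \<pi> (\<lambda>x. c) = c"
  by (simp add: expect_def sum_distrib_right[symmetric] mass_total)

lemma variance_le_centred: "variance_of \<pi> f \<le> second_moment \<pi> (\<lambda>x. f x - c)"
proof -
  have "second_moment \<pi> (\<lambda>x. f x - c) = expect \<pi> (\<lambda>x. (f x)\<^sup>2 + ((- 2 * c) * f x + c\<^sup>2))"
    by (simp add: power2_diff algebra_simps)
  also have "\<dots> = second_moment \<pi> f - 2 * c * expect \<pi> f + c\<^sup>2"
    by (simp only: expect_add expect_cmult expect_const)
  also have "\<dots> = variance_of \<pi> f + (expect \<pi> f - c)\<^sup>2"
    by (simp add: variance_of_def power2_diff)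
  finally show ?thesis by simp
qed

text \<open>
  The least value of \<open>f\<close> that is exceeded with probability at most \<open>1 / 2\<close> is a median.
\<close>

lemma exists_median:
  fixes f :: "'a \<Rightarrow> real"
  obtains c where "sum \<pi> {x. c < f x} \<le> 1 / 2" "sum \<pi> {x. f x < c} \<le> 1 / 2"
proof -
  define C where "C = {c \<in> range f. sum \<pi> {x. c < f x} \<le> 1 / 2}"
  define M where "M = Max (range f)"
  have "f x \<le> M" for x by (simp add: M_def)
  then have "{x. M < f x} = {}" unfolding not_less[symmetric] by blast
  moreover have "M \<in> range f" unfolding M_def by (intro Max_in) auto
  ultimately have "M \<in> C" by (simp add: C_def)
  then have ne: "C \<noteq> {}" "finite C" by (auto simp: C_def)
  define c where "c = Min C"
  have c: "c \<in> C" unfolding c_def using ne by (intro Min_in)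
  have "sum \<pi> {x. f x < c} \<le> 1 / 2"
  proof (cases "{x. f x < c} = {}")
    case False
    define d where "d = Max (f ` {x. f x < c})"
    have "d \<in> f ` {x. f x < c}" unfolding d_def using False by (intro Max_in) auto
    then have d: "d \<in> range f" "d < c" by auto
    \<comment> \<open>The next smaller value \<open>d\<close> is exceeded with probability more than \<open>1 / 2\<close>.\<close>
    have "d \<notin> C"
      using Min_le[OF ne(2), of d] d(2) by (auto simp: c_def)
    then have "1 / 2 < sum \<pi> {x. d < f x}" using d(1) by (auto simp: C_def)
    moreover have "f x \<le> d" if "f x < c" for x
      unfolding d_def using that by (intro Max_ge) auto
    then have "{x. f x < c} \<subseteq> - {x. d < f x}" using leD by blast
    then have "sum \<pi> {x. f x < c} \<le> sum \<pi> (- {x. d < f x})"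
      using mass_nonneg by (intro sum_mono2) auto
    moreover have "sum \<pi> {x. d < f x} + sum \<pi> (- {x. d < f x}) = 1"
      using sum.union_disjoint[of "{x. d < f x}" "- {x. d < f x}" \<pi>] mass_total by (simp add: Compl_partition)
    ultimately show ?thesis by linarith
  qed simp
  then show ?thesis using that c by (auto simp: C_def)
qed

lemma cheeger_inequality_profile:
  assumes "\<And>x. 0 \<le> g x" "sum \<pi> {x. 0 < g x} \<le> r" "min_mass \<pi> \<le> r" "r < 1"
  shows "(\<Phi> r)\<^sup>2 / 2 * second_moment \<pi> g \<le> dirichlet_form K \<pi> g"
proof (rule cheeger_inequality[OF assms(1)])
  fix S assume S: "S \<noteq> {}" "S \<subseteq> {x. 0 < g x}"
  then have "sum \<pi> S \<le> sum \<pi> {x. 0 < g x}" using mass_nonneg by (intro sum_mono2) auto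
  then show "\<Phi> r * sum \<pi> S \<le> boundary_size K \<pi> S"
    using S assms by (intro conductance_profile_le) auto
qed (use conductance_profile_pos[OF assms(3,4)] in simp)

text \<open>
  Both parts of \<open>f\<close> around a median have support of mass at most \<open>1 / 2\<close>, so Cheeger's inequality
  with constant \<open>\<Phi>(1 / 2)\<close> applies to each.
\<close>

lemma poincare_half:
  "(\<Phi> (1 / 2))\<^sup>2 / 2 * variance_of \<pi> f \<le> dirichlet_form K \<pi> f"
proof -
  obtain c where c: "sum \<pi> {x. c < f x} \<le> 1 / 2" "sum \<pi> {x. f x < c} \<le> 1 / 2"
    by (rule exists_median)
  define p q where pq: "p x = max 0 (f x - c)" "q x = max 0 (c - f x)" for x
  have supp: "{x. 0 < p x} = {x. c < f x}" "{x. 0 < q x} = {x. f x < c}"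
    by (auto simp: pq max_def)
  have "variance_of \<pi> f \<le> second_moment \<pi> (\<lambda>x. f x - c)" by (rule variance_le_centred)
  also have "\<dots> = second_moment \<pi> p + second_moment \<pi> q"
    unfolding expect_add[symmetric]
    by (intro arg_cong[of _ _ "expect \<pi>"]) (auto simp: pq max_def power2_commute fun_eq_iff)
  finally have "(\<Phi> (1 / 2))\<^sup>2 / 2 * variance_of \<pi> f
      \<le> (\<Phi> (1 / 2))\<^sup>2 / 2 * second_moment \<pi> p + (\<Phi> (1 / 2))\<^sup>2 / 2 * second_moment \<pi> q"
    unfolding distrib_left[symmetric] by (rule mult_left_mono) simp
  also have "\<dots> \<le> dirichlet_form K \<pi> p + dirichlet_form K \<pi> q"
    using c min_mass_le_half
    by (intro add_mono cheeger_inequality_profile) (auto simp: supp, auto simp: pq)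
  also have "\<dots> \<le> dirichlet_form K \<pi> f"
    unfolding pq by (rule dirichlet_form_split)
  finally show ?thesis .
qed

text \<open>
  The truncation of \<open>\<Phi>\<close> at \<open>1 / 2\<close> is what makes one statement cover all supports: a large
  support gives no isoperimetric information, and the median argument takes over.
\<close>

lemma faber_krahn:
  assumes "\<And>x. 0 \<le> g x" "sum \<pi> {x. 0 < g x} \<le> r" "min_mass \<pi> \<le> r"
  shows "(\<Phi>\<^sub>* r)\<^sup>2 / 2 * variance_of \<pi> g \<le> dirichlet_form K \<pi> g"
proof (cases "r < 1 / 2")
  case True
  have "variance_of \<pi> g \<le> second_moment \<pi> g" by (simp add: variance_of_def)
  then have "(\<Phi> r)\<^sup>2 / 2 * variance_of \<pi> g \<le> (\<Phi> r)\<^sup>2 / 2 * second_moment \<pi> g"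
    by (rule mult_left_mono) simp
  also have "\<dots> \<le> dirichlet_form K \<pi> g"
    using assms True by (intro cheeger_inequality_profile) auto
  finally show ?thesis using True by (simp add: trunc_conductance_profile_def)
next
  case False
  then show ?thesis using poincare_half by (simp add: trunc_conductance_profile_def)
qed

text \<open>
  The level \<open>c = v / (4 * m)\<close>, for mean \<open>m\<close> and variance \<open>v\<close>, is chosen such that cutting \<open>f\<close> at
  \<open>c\<close> lowers the second moment by at most \<open>2 * c * m = v / 2\<close>. The mean does not increase, so half
  of the variance survives. Markov's inequality bounds the mass of the remaining support by
  \<open>m / c = r\<close>, and cutting can only decrease the Dirichlet form.
\<close>

lemma dirichlet_form_ge_profile:
  assumes f: "\<And>x. 0 \<le> f x" and v: "0 < variance_of \<pi> f"
  defines "r \<equiv> 4 * (expect \<pi> f)\<^sup>2 / variance_of \<pi> f"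
  shows "(\<Phi>\<^sub>* r)\<^sup>2 / 4 * variance_of \<pi> f \<le> dirichlet_form K \<pi> f"
proof -
  define m where "m = expect \<pi> f"
  define v where "v = variance_of \<pi> f"
  have "0 \<le> m" unfolding m_def expect_def by (intro sum_nonneg mult_nonneg_nonneg mass_nonneg f)
  moreover have "m \<noteq> 0"
  proof
    assume "m = 0"
    then have "\<pi> x * f x = 0" for x
      unfolding m_def expect_def by (subst (asm) sum_nonneg_eq_0_iff) (auto simp: mass_nonneg f)
    then have "f x = 0" for x using mass_pos[of x] by (metis mult_eq_0_iff less_irrefl)
    then show False using v by (simp add: variance_of_def expect_def)
  qed
  ultimately have m: "0 < m" by simp
  have v_pos: "0 < v" using v by (simp add: v_def)
  have v_eq: "v = second_moment \<pi> f - m\<^sup>2" by (simp add: v_def m_def variance_of_def)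
  define c where "c = v / (4 * m)"
  have c: "0 < c" using m v_pos by (simp add: c_def)
  define g where "g x = max 0 (f x - c)" for x
  have g: "0 \<le> g x" "g x \<le> f x" for x using f[of x] c by (auto simp: g_def)
  have "(expect \<pi> g)\<^sup>2 \<le> m\<^sup>2"
    unfolding m_def
    by (intro power_mono expect_mono g) (auto simp: expect_def intro!: sum_nonneg mult_nonneg_nonneg mass_nonneg g)
  moreover have "second_moment \<pi> f - 2 * c * m \<le> second_moment \<pi> g"
  proof -
    have "expect \<pi> (\<lambda>x. (f x)\<^sup>2 + (- 2 * c) * f x) \<le> second_moment \<pi> g"
    proof (rule expect_mono)
      fix x
      show "(f x)\<^sup>2 + (- 2 * c) * f x \<le> (g x)\<^sup>2"
      proof (cases "c \<le> f x")
        case True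
        then have "(g x)\<^sup>2 = (f x)\<^sup>2 + (- 2 * c) * f x + c\<^sup>2"
          by (simp add: g_def power2_diff algebra_simps)
        then show ?thesis by simp
      next
        case False
        then have "f x * f x \<le> c * f x" "0 \<le> c * f x"
          using f[of x] c by (auto intro: mult_right_mono)
        then show ?thesis using False by (simp add: g_def power2_eq_square)
      qed
    qed
    then show ?thesis by (simp only: expect_add expect_cmult m_def)
  qed
  moreover have "2 * c * m = v / 2" using m by (simp add: c_def)
  ultimately have var_g: "v / 2 \<le> variance_of \<pi> g"
    unfolding variance_of_def[of \<pi> g] using v_eq by linarith
  have markov: "sum \<pi> {x. 0 < g x} \<le> r"
  proof -
    have supp: "{x. 0 < g x} = {x. c < f x}" by (auto simp: g_def max_def)
    have "c * sum \<pi> {x. 0 < g x} = (\<Sum>x\<in>{x. 0 < g x}. \<pi> x * c)"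
      by (simp add: sum_distrib_right[symmetric])
    also have "\<dots> \<le> (\<Sum>x\<in>{x. 0 < g x}. \<pi> x * f x)"
      unfolding supp by (intro sum_mono mult_left_mono mass_nonneg) auto
    also have "\<dots> \<le> m"
      unfolding m_def expect_def by (intro sum_mono2) (auto simp: mass_nonneg f)
    finally have "sum \<pi> {x. 0 < g x} \<le> m / c" using c by (simp add: field_simps)
    also have "m / c = r" using m v_pos by (simp add: c_def r_def m_def v_def power2_eq_square)
    finally show ?thesis .
  qed
  have "{x. 0 < g x} \<noteq> {}"
  proof
    assume "{x. 0 < g x} = {}"
    then have "g x = 0" for x using g(1)[of x] by (simp add: set_eq_iff not_less order.eq_iff)
    then show False using var_g v_pos by (simp add: variance_of_def expect_def)
  qed
  then have "min_mass \<pi> \<le> r" using min_mass_le_sum markov by (meson order_trans)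
  have "(\<Phi>\<^sub>* r)\<^sup>2 / 4 * v = (\<Phi>\<^sub>* r)\<^sup>2 / 2 * (v / 2)" by simp
  also have "\<dots> \<le> (\<Phi>\<^sub>* r)\<^sup>2 / 2 * variance_of \<pi> g" using var_g by (intro mult_left_mono) auto
  also have "\<dots> \<le> dirichlet_form K \<pi> g" by (intro faber_krahn g markov \<open>min_mass \<pi> \<le> r\<close>)
  also have "\<dots> \<le> dirichlet_form K \<pi> f" by (rule dirichlet_form_contraction) (auto simp: g_def)
  finally show ?thesis by (simp add: v_def)
qed

section \<open>The heat kernel\<close>

lemma heat_series_summable: "summable (\<lambda>n. kernel_pow K n x y / fact n * t ^ n)"
proof (rule summable_comparison_test')
  show "summable (\<lambda>n. \<bar>t\<bar> ^ n /\<^sub>R fact n)" by (rule summable_exp_generic)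
  show "norm (kernel_pow K n x y / fact n * t ^ n) \<le> \<bar>t\<bar> ^ n /\<^sub>R fact n" for n
    using mult_right_mono[OF kernel_pow_le_1[of n x y], of "\<bar>t\<bar> ^ n"] kernel_pow_nonneg[of n x y]
    by (simp add: abs_mult power_abs divide_simps)
qed

lemma heat_kernel_eq: "heat_kernel K t x y = exp (- t) * (\<Sum>n. kernel_pow K n x y / fact n * t ^ n)"
  by (simp add: heat_kernel_def mult_ac)

lemma heat_kernel_0: "heat_kernel K 0 x y = of_bool (x = y)"
proof -
  have "(\<Sum>n. kernel_pow K n x y / fact n * 0 ^ n) = kernel_pow K 0 x y"
    using powser_zero[of "\<lambda>n. kernel_pow K n x y / fact n"] by simp
  then show ?thesis by (simp add: heat_kernel_eq)
qed

lemma heat_kernel_nonneg: "0 \<le> t \<Longrightarrow> 0 \<le> heat_kernel K t x y"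
  unfolding heat_kernel_eq
  by (intro mult_nonneg_nonneg suminf_nonneg heat_series_summable)
     (auto intro!: mult_nonneg_nonneg divide_nonneg_nonneg kernel_pow_nonneg)

lemma exp_series_sums: "(\<lambda>n. 1 / fact n * t ^ n) sums exp (t::real)"
  using exp_converges[of t] by (simp add: field_simps)

text \<open>
  Any linear identity that all powers of \<open>K\<close> share passes to the heat kernel, because the Poisson
  weights sum to 1. The index maps \<open>p\<close> and \<open>q\<close> let one statement serve sums over rows and sums over
  columns.
\<close>

lemma heat_kernel_weighted_sum:
  assumes "\<And>n. (\<Sum>z\<in>A. a z * kernel_pow K n (p z) (q z)) = b"
  shows "(\<Sum>z\<in>A. a z * heat_kernel K t (p z) (q z)) = b"
proof -
  have "(\<lambda>n. \<Sum>z\<in>A. a z * (kernel_pow K n (p z) (q z) / fact n * t ^ n))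
      sums (\<Sum>z\<in>A. a z * (\<Sum>n. kernel_pow K n (p z) (q z) / fact n * t ^ n))"
    by (intro sums_sum sums_mult summable_sums heat_series_summable)
  moreover have "(\<Sum>z\<in>A. a z * (kernel_pow K n (p z) (q z) / fact n * t ^ n)) = b * (1 / fact n * t ^ n)" for n
    unfolding assms[of n, symmetric] by (simp add: sum_distrib_right sum_divide_distrib mult.assoc)
  ultimately have "(\<Sum>z\<in>A. a z * (\<Sum>n. kernel_pow K n (p z) (q z) / fact n * t ^ n)) = b * exp t"
    using sums_mult[OF exp_series_sums, of b t] sums_unique2 by simp
  then have "(\<Sum>z\<in>A. a z * heat_kernel K t (p z) (q z)) = exp (- t) * (b * exp t)"
    by (simp add: heat_kernel_eq sum_distrib_left[symmetric] mult.left_commute[of _ "exp (- t)"])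
  then show ?thesis by (simp add: exp_minus)
qed

lemma heat_kernel_row_sum: "(\<Sum>y\<in>UNIV. heat_kernel K t x y) = 1"
  using heat_kernel_weighted_sum[where A = UNIV and a = "\<lambda>_. 1" and p = "\<lambda>_. x" and q = "\<lambda>y. y"] by (simp add: kernel_pow_row_sum)

lemma mass_heat_kernel: "(\<Sum>x\<in>UNIV. \<pi> x * heat_kernel K t x y) = \<pi> y"
  using heat_kernel_weighted_sum[where A = UNIV and a = \<pi> and p = "\<lambda>x. x" and q = "\<lambda>_. y"] by (simp add: mass_kernel_pow)

lemma kernel_pow_Suc_right: "kernel_pow K (Suc n) x y = (\<Sum>z\<in>UNIV. kernel_pow K n x z * K z y)"
proof (induction n arbitrary: x)
  case 0
  show ?case
    by (simp add: if_distrib[of "\<lambda>c. c * _"] if_distrib[of "\<lambda>c. _ * c"] sum.delta sum.delta' cong: if_cong)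
next
  case (Suc n)
  have "kernel_pow K (Suc (Suc n)) x y = (\<Sum>z\<in>UNIV. K x z * (\<Sum>w\<in>UNIV. kernel_pow K n z w * K w y))"
    using Suc by simp
  also have "\<dots> = (\<Sum>w\<in>UNIV. (\<Sum>z\<in>UNIV. K x z * kernel_pow K n z w) * K w y)"
    by (simp add: sum_distrib_left sum_distrib_right mult.assoc) (rule sum.swap)
  finally show ?case by simp
qed

text \<open>
  Differentiating the power series shifts the exponent by one. Factoring \<open>K\<close> out of the next power
  on the left or on the right gives the backward and the forward equation.
\<close>

lemma heat_kernel_deriv:
  assumes "\<And>n. kernel_pow K (Suc n) x y = (\<Sum>z\<in>UNIV. a z * kernel_pow K n (p z) (q z))"
  shows "((\<lambda>t. heat_kernel K t x y) has_real_derivative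
    (\<Sum>z\<in>UNIV. a z * heat_kernel K t (p z) (q z)) - heat_kernel K t x y) (at t)"
proof -
  let ?c = "\<lambda>n. kernel_pow K n x y / fact n"
  let ?S = "\<lambda>t. \<Sum>n. ?c n * t ^ n"
  have "diffs ?c n = kernel_pow K (Suc n) x y / fact n" for n
    by (simp add: diffs_def del: kernel_pow.simps)
  then have "(\<Sum>n. diffs ?c n * t ^ n)
      = (\<Sum>n. \<Sum>z\<in>UNIV. a z * (kernel_pow K n (p z) (q z) / fact n * t ^ n))"
    by (simp add: assms sum_distrib_right sum_divide_distrib mult.assoc del: kernel_pow.simps)
  also have "\<dots> = (\<Sum>z\<in>UNIV. a z * (\<Sum>n. kernel_pow K n (p z) (q z) / fact n * t ^ n))"
    by (intro sums_unique[symmetric] sums_sum sums_mult summable_sums heat_series_summable)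
  finally have "(?S has_real_derivative
      (\<Sum>z\<in>UNIV. a z * (\<Sum>n. kernel_pow K n (p z) (q z) / fact n * t ^ n))) (at t)"
    using termdiffs_strong_converges_everywhere[of ?c t] heat_series_summable by simp
  moreover have "((\<lambda>t. exp (- t)) has_real_derivative - exp (- t)) (at t)"
    by (auto intro!: derivative_eq_intros)
  ultimately have "((\<lambda>t. exp (- t) * ?S t) has_real_derivative
      (- exp (- t)) * ?S t
        + (\<Sum>z\<in>UNIV. a z * (\<Sum>n. kernel_pow K n (p z) (q z) / fact n * t ^ n)) * exp (- t)) (at t)"
    by (intro DERIV_mult)
  then show ?thesis
    unfolding heat_kernel_eq by (simp add: sum_distrib_left mult_ac)
qed

lemmas heat_kernel_backward_equation = heat_kernel_deriv[OF kernel_pow.simps(2)]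
lemmas heat_kernel_forward_equation =
  heat_kernel_deriv[OF trans[OF kernel_pow_Suc_right sum.cong[OF refl mult.commute]]]

text \<open>
  With \<open>s + t\<close> fixed, the right side does not depend on \<open>s\<close>: the forward equation for the first factor
  and the backward equation for the second one cancel. At \<open>s = 0\<close> it is the left side.
\<close>

lemma heat_kernel_semigroup:
  "heat_kernel K (s + t) x y = (\<Sum>z\<in>UNIV. heat_kernel K s x z * heat_kernel K t z y)"
proof -
  let ?H = "heat_kernel K"
  define T where "T = s + t"
  have "((\<lambda>r. \<Sum>z\<in>UNIV. ?H r x z * ?H (T - r) z y) has_real_derivative 0) (at r)" for r
  proof -
    have reversed: "((\<lambda>r. ?H (T - r) z y) has_real_derivative
        - ((\<Sum>w\<in>UNIV. K z w * ?H (T - r) w y) - ?H (T - r) z y)) (at r)" for z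
    proof -
      have "((\<lambda>r. T - r) has_real_derivative - 1) (at r)"
        by (auto intro!: derivative_eq_intros)
      from DERIV_chain2[where f = "\<lambda>t. ?H t z y", OF heat_kernel_backward_equation this]
      show ?thesis by simp
    qed
    have "((\<lambda>r. \<Sum>z\<in>UNIV. ?H r x z * ?H (T - r) z y) has_real_derivative
        (\<Sum>z\<in>UNIV. ((\<Sum>w\<in>UNIV. K w z * ?H r x w) - ?H r x z) * ?H (T - r) z y
          + - ((\<Sum>w\<in>UNIV. K z w * ?H (T - r) w y) - ?H (T - r) z y) * ?H r x z)) (at r)"
      by (intro DERIV_sum DERIV_mult heat_kernel_forward_equation reversed)
    moreover have "(\<Sum>z\<in>UNIV. (\<Sum>w\<in>UNIV. K w z * ?H r x w) * ?H (T - r) z y)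
        = (\<Sum>z\<in>UNIV. (\<Sum>w\<in>UNIV. K z w * ?H (T - r) w y) * ?H r x z)"
      by (simp add: sum_distrib_left mult_ac) (rule sum.swap)
    ultimately show ?thesis
      by (simp add: algebra_simps sum.distrib sum_subtractf)
  qed
  then have "(\<Sum>z\<in>UNIV. ?H s x z * ?H (T - s) z y) = (\<Sum>z\<in>UNIV. ?H 0 x z * ?H (T - 0) z y)"
    using DERIV_isconst_all[of "\<lambda>r. \<Sum>z\<in>UNIV. ?H r x z * ?H (T - r) z y" s 0] by blast
  also have "\<dots> = ?H T x y"
    by (simp add: heat_kernel_0 of_bool_def if_distrib[of "\<lambda>c. c * _"] cong: if_cong)
  finally show ?thesis by (simp add: T_def)
qed

section \<open>Decay of the variance\<close>

text \<open>
  This is nonnegativity of the second moments of \<open>(u - 1) + (v - 1)\<close> and \<open>(u - 1) - (v - 1)\<close>.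
\<close>

lemma mean_one_covariance_bound:
  assumes "expect \<pi> u = 1" "expect \<pi> v = 1"
  shows "\<bar>expect \<pi> (\<lambda>x. u x * v x) - 1\<bar> \<le> (variance_of \<pi> u + variance_of \<pi> v) / 2"
proof -
  have bound: "0 \<le> second_moment \<pi> u + (second_moment \<pi> v + (2 * s * expect \<pi> (\<lambda>x. u x * v x)
      + (- 2 * (1 + s) * expect \<pi> u + (- 2 * (1 + s) * expect \<pi> v + 2 * (1 + s)))))" if "s * s = 1" for s
  proof -
    have expand: "(u x - 1 + s * (v x - 1))\<^sup>2 = (u x)\<^sup>2 + ((v x)\<^sup>2 + (2 * s * (u x * v x)
      + (- 2 * (1 + s) * u x + (- 2 * (1 + s) * v x + 2 * (1 + s)))))" for x
    proof -
      have "(u x - 1 + s * (v x - 1))\<^sup>2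
          = (u x - 1)\<^sup>2 + (s * s) * (v x - 1)\<^sup>2 + 2 * s * (u x - 1) * (v x - 1)"
        by (simp add: power2_eq_square algebra_simps)
      then show ?thesis
        using that by (simp add: power2_eq_square algebra_simps)
    qed
    have "0 \<le> expect \<pi> (\<lambda>x. (u x - 1 + s * (v x - 1))\<^sup>2)"
      unfolding expect_def by (intro sum_nonneg mult_nonneg_nonneg mass_nonneg) auto
    then show ?thesis unfolding expand by (simp only: expect_add expect_cmult expect_const)
  qed
  from bound[of 1] bound[of "- 1"] show ?thesis
    unfolding abs_le_iff variance_of_def assms by (simp add: field_simps)
qed

text \<open>
  The second hypothesis says that the generator has the quadratic form of \<open>K\<close>. It is stated for the
  form only, so that it holds for densities that evolve under \<open>K\<close> as well as for those that evolve
  under the time reversal of \<open>K\<close>.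
\<close>

lemma second_moment_deriv:
  assumes deriv: "\<And>x. ((\<lambda>t. u t x) has_real_derivative G x - u t x) (at t)"
    and generator: "(\<Sum>x\<in>UNIV. \<pi> x * (u t x * G x)) = (\<Sum>x\<in>UNIV. \<Sum>y\<in>UNIV. \<pi> x * K x y * (u t x * u t y))"
  shows "((\<lambda>t. second_moment \<pi> (u t)) has_real_derivative - 2 * dirichlet_form K \<pi> (u t)) (at t)"
proof -
  have "((\<lambda>t. \<Sum>x\<in>UNIV. \<pi> x * (u t x)\<^sup>2) has_real_derivative
      (\<Sum>x\<in>UNIV. \<pi> x * (2 * (u t x * (G x - u t x))))) (at t)"
    by (intro DERIV_sum) (auto intro!: derivative_eq_intros deriv)
  moreover have "(\<Sum>x\<in>UNIV. \<pi> x * (2 * (u t x * (G x - u t x))))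
      = 2 * ((\<Sum>x\<in>UNIV. \<pi> x * (u t x * G x)) - second_moment \<pi> (u t))"
    by (simp add: expect_def sum_distrib_left sum_subtractf[symmetric] power2_eq_square algebra_simps)
  ultimately show ?thesis
    unfolding generator dirichlet_form_eq by (simp add: expect_def)
qed

lemma half_square_profile_pos:
  assumes "min_mass \<pi> \<le> r"
  shows "0 < (\<Phi>\<^sub>* r)\<^sup>2 / 2"
  using trunc_profile_pos[OF assms] by simp

lemma half_square_profile_antimono:
  assumes "min_mass \<pi> \<le> r" "r \<le> s"
  shows "(\<Phi>\<^sub>* s)\<^sup>2 / 2 \<le> (\<Phi>\<^sub>* r)\<^sup>2 / 2"
  using trunc_profile_antimono[OF assms] trunc_profile_pos[of s] assms
  by (intro divide_right_mono power_mono) auto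

lemma profile_integrable:
  assumes "min_mass \<pi> \<le> a"
  shows "(\<lambda>v. 1 / (v * ((\<Phi>\<^sub>* v)\<^sup>2 / 2))) integrable_on {a..b}"
  by (rule integrable_inverse_times_antimono
      [OF min_mass_pos assms half_square_profile_pos half_square_profile_antimono])

lemma integral_profile_pos:
  assumes "min_mass \<pi> \<le> a" "a < b"
  shows "0 < integral {a..b} (\<lambda>v. 1 / (v * ((\<Phi>\<^sub>* v)\<^sup>2 / 2)))"
proof -
  have a: "0 < a" using assms min_mass_pos by auto
  have lower: "1 / (b * ((\<Phi>\<^sub>* a)\<^sup>2 / 2)) \<le> 1 / (v * ((\<Phi>\<^sub>* v)\<^sup>2 / 2))" if "v \<in> {a..b}" for v
  proof (rule divide_left_mono)
    have v: "min_mass \<pi> \<le> v" "a \<le> v" "0 < v" "v \<le> b" using that assms a by auto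
    show "v * ((\<Phi>\<^sub>* v)\<^sup>2 / 2) \<le> b * ((\<Phi>\<^sub>* a)\<^sup>2 / 2)"
      using v a half_square_profile_antimono[OF assms(1), of v] by (intro mult_mono) auto
    show "0 < (b * ((\<Phi>\<^sub>* a)\<^sup>2 / 2)) * (v * ((\<Phi>\<^sub>* v)\<^sup>2 / 2))"
      using v a half_square_profile_pos[OF v(1)] half_square_profile_pos[OF assms(1)]
      by (intro mult_pos_pos) auto
  qed simp
  have "0 < (b - a) * (1 / (b * ((\<Phi>\<^sub>* a)\<^sup>2 / 2)))"
    using assms a trunc_profile_pos[of a] by simp
  also have "\<dots> = integral {a..b} (\<lambda>v. 1 / (b * ((\<Phi>\<^sub>* a)\<^sup>2 / 2)))"
    using assms by simp
  also have "\<dots> \<le> integral {a..b} (\<lambda>v. 1 / (v * ((\<Phi>\<^sub>* v)\<^sup>2 / 2)))"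
    by (intro integral_le profile_integrable assms lower) auto
  finally show ?thesis .
qed

text \<open>
  If the variance \<open>I\<close> were still above \<open>\<epsilon>\<close> at time \<open>T\<close>, then \<open>J = 4 / I\<close> would stay in
  \<open>[4 * min_mass \<pi>, 4 / \<epsilon>)\<close> up to time \<open>T\<close>. The comparison principle would then bound \<open>T\<close> by an
  integral over a proper part of the interval that defines \<open>T\<close>.
\<close>

lemma variance_decay:
  fixes u :: "real \<Rightarrow> 'a \<Rightarrow> real"
  assumes nonneg: "\<And>t x. 0 \<le> t \<Longrightarrow> 0 \<le> u t x"
    and mean: "\<And>t. 0 \<le> t \<Longrightarrow> expect \<pi> (u t) = 1"
    and deriv: "\<And>t. 0 \<le> t \<Longrightarrow>
      ((\<lambda>t. second_moment \<pi> (u t)) has_real_derivative - 2 * dirichlet_form K \<pi> (u t)) (at t)"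
    and initial: "second_moment \<pi> (u 0) \<le> 1 / min_mass \<pi>"
    and \<epsilon>: "0 < \<epsilon>" "\<epsilon> < 1 / min_mass \<pi>"
  defines "T \<equiv> integral {4 * min_mass \<pi>..4 / \<epsilon>} (\<lambda>v. 1 / (v * ((\<Phi>\<^sub>* v)\<^sup>2 / 2)))"
  shows "variance_of \<pi> (u T) \<le> \<epsilon>"
proof (rule ccontr)
  assume large: "\<not> variance_of \<pi> (u T) \<le> \<epsilon>"
  let ?c = "4 * min_mass \<pi>"
  let ?w = "\<lambda>v. (\<Phi>\<^sub>* v)\<^sup>2 / 2"
  let ?g = "\<lambda>v. 1 / (v * ?w v)"
  have c_less: "?c < 4 / \<epsilon>" using \<epsilon> min_mass_pos by (simp add: field_simps)
  then have "0 < T" unfolding T_def using min_mass_pos by (intro integral_profile_pos) auto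
  define I where "I t = second_moment \<pi> (u t) - 1" for t
  have I_variance: "I t = variance_of \<pi> (u t)" if "0 \<le> t" for t
    using mean[OF that] by (simp add: I_def variance_of_def)
  have I_deriv: "(I has_real_derivative - 2 * dirichlet_form K \<pi> (u t)) (at t)" if "0 \<le> t" for t
    unfolding I_def using deriv[OF that] by (auto intro!: derivative_eq_intros)
  have I_mono: "I b \<le> I a" if "0 \<le> a" "a \<le> b" for a b
    using that by (intro DERIV_nonpos_imp_nonincreasing[of a b I]) (auto intro!: exI I_deriv dirichlet_form_nonneg)
  have I_bounds: "\<epsilon> < I t" "I t \<le> 1 / min_mass \<pi>" if "0 \<le> t" "t \<le> T" for t
    using that I_mono[of t T] I_mono[of 0 t] large I_variance[of T] initial \<open>0 < T\<close> by (auto simp: I_def)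
  define J where "J t = 4 / I t" for t
  have c_le: "?c \<le> J t" if "0 \<le> t" "t \<le> T" for t
    using I_bounds[OF that] \<epsilon> min_mass_pos by (simp add: J_def field_simps)
  have "T \<le> integral {J 0..J T} ?g"
  proof (rule log_growth_comparison[where c = ?c and J' = "\<lambda>t. 8 * dirichlet_form K \<pi> (u t) / (I t)\<^sup>2"])
    fix t assume t: "0 \<le> t" "t \<le> T"
    then have I: "0 < I t" using I_bounds \<epsilon> by force
    show "(J has_real_derivative 8 * dirichlet_form K \<pi> (u t) / (I t)\<^sup>2) (at t)"
      unfolding J_def using I
      by (auto intro!: derivative_eq_intros I_deriv t simp: power2_eq_square)
    have "(\<Phi>\<^sub>* (J t))\<^sup>2 / 4 * I t \<le> dirichlet_form K \<pi> (u t)"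
      using dirichlet_form_ge_profile[of "u t"] nonneg[OF t(1)] I mean[OF t(1)]
      by (simp add: J_def I_variance[OF t(1), symmetric])
    then have "8 * ((\<Phi>\<^sub>* (J t))\<^sup>2 / 4 * I t) / (I t)\<^sup>2 \<le> 8 * dirichlet_form K \<pi> (u t) / (I t)\<^sup>2"
      by (intro divide_right_mono) (auto simp: mult_ac)
    moreover have "8 * ((\<Phi>\<^sub>* (J t))\<^sup>2 / 4 * I t) / (I t)\<^sup>2 = J t * ?w (J t)"
      using I unfolding J_def by (simp add: power2_eq_square[of "I t"])
    ultimately show "J t * ?w (J t) \<le> 8 * dirichlet_form K \<pi> (u t) / (I t)\<^sup>2"
      by simp
  next
    show "0 < ?w v" if "?c \<le> v" for v
      using that min_mass_pos by (intro half_square_profile_pos) auto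
    show "?w v \<le> ?w u" if "?c \<le> u" "u \<le> v" for u v
      using that min_mass_pos by (intro half_square_profile_antimono) auto
  qed (use \<open>0 < T\<close> c_le min_mass_pos in auto)
  also have "\<dots> \<le> integral {?c..J T} ?g"
    using c_le[of 0] \<open>0 < T\<close> min_mass_pos
    by (intro integral_subset_le profile_integrable) auto
  also have "\<dots> < integral {?c..J T} ?g + integral {J T..4 / \<epsilon>} ?g"
  proof -
    have "J T < 4 / \<epsilon>"
      unfolding J_def using I_bounds[of T] \<open>0 < T\<close> \<epsilon> by (intro divide_strict_left_mono) auto
    then show ?thesis using integral_profile_pos[of "J T"] c_le[of T] \<open>0 < T\<close> min_mass_pos by simp
  qed
  also have "\<dots> = integral {?c..4 / \<epsilon>} ?g"
  proof (intro Henstock_Kurzweil_Integration.integral_combine profile_integrable)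
    show "?c \<le> J T" using c_le[of T] \<open>0 < T\<close> by simp
    show "J T \<le> 4 / \<epsilon>"
      unfolding J_def using I_bounds[of T] \<open>0 < T\<close> \<epsilon> by (intro divide_left_mono) auto
  qed (use min_mass_pos in simp)
  also have "\<dots> = T" by (simp only: T_def)
  finally show False by simp
qed

section \<open>The mixing time bound\<close>

text \<open>
  The row density \<open>u\<close> obeys the forward equation and the column density \<open>v\<close> the backward equation;
  each starts from a point mass, whose second moment is the inverse of the mass of the point.
\<close>

lemma heat_kernel_density_bound:
  assumes \<epsilon>: "0 < \<epsilon>" "\<epsilon> < 1 / min_mass \<pi>"
  defines "T \<equiv> integral {4 * min_mass \<pi>..4 / \<epsilon>} (\<lambda>v. 1 / (v * ((\<Phi>\<^sub>* v)\<^sup>2 / 2)))"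
  shows "\<bar>(heat_kernel K (2 * T) x y - \<pi> y) / \<pi> y\<bar> \<le> \<epsilon>"
proof -
  have "0 < T" unfolding T_def using \<epsilon> min_mass_pos
    by (intro integral_profile_pos) (auto simp: field_simps)
  have inverse_mass: "1 / \<pi> z \<le> 1 / min_mass \<pi>" for z
    using min_mass_le[of z] min_mass_pos by (intro divide_left_mono) (auto simp: mass_pos)
  define u v where "u t z = heat_kernel K t x z / \<pi> z" and "v t z = heat_kernel K t z y / \<pi> y" for t z
  have mass_u: "\<pi> z * u t z = heat_kernel K t x z" for t z
    using mass_pos[of z] by (simp add: u_def)
  have u_mean: "expect \<pi> (u t) = 1" for t
    by (simp add: expect_def mass_u heat_kernel_row_sum)
  have v_mean: "expect \<pi> (v t) = 1" for t
    using mass_heat_kernel[of t y] mass_pos[of y] by (simp add: expect_def v_def sum_divide_distrib[symmetric])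
  have var_u: "variance_of \<pi> (u T) \<le> \<epsilon>"
    unfolding T_def
  proof (rule variance_decay[OF _ u_mean _ _ \<epsilon>])
    show "0 \<le> u t z" if "0 \<le> t" for t z
      using heat_kernel_nonneg[OF that] mass_nonneg by (simp add: u_def)
    show "((\<lambda>t. second_moment \<pi> (u t)) has_real_derivative - 2 * dirichlet_form K \<pi> (u t)) (at t)" for t
    proof (rule second_moment_deriv)
      show "((\<lambda>t. u t z) has_real_derivative (\<Sum>w\<in>UNIV. K w z * heat_kernel K t x w) / \<pi> z - u t z) (at t)" for z
        unfolding u_def diff_divide_distrib[symmetric]
        by (intro DERIV_cdivide heat_kernel_forward_equation)
      have "\<pi> z * (u t z * ((\<Sum>w\<in>UNIV. K w z * heat_kernel K t x w) / \<pi> z))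
          = (\<Sum>w\<in>UNIV. \<pi> w * K w z * (u t w * u t z))" for z
        using mass_pos[of z] by (simp add: sum_distrib_left sum_divide_distrib mass_u[symmetric] mult_ac)
      then show "(\<Sum>z\<in>UNIV. \<pi> z * (u t z * ((\<Sum>w\<in>UNIV. K w z * heat_kernel K t x w) / \<pi> z)))
          = (\<Sum>w\<in>UNIV. \<Sum>z\<in>UNIV. \<pi> w * K w z * (u t w * u t z))"
        by (simp only:) (rule sum.swap)
    qed
    have "second_moment \<pi> (u 0) = (\<Sum>z\<in>UNIV. if x = z then 1 / \<pi> z else 0)"
      unfolding expect_def u_def heat_kernel_0 using mass_pos
      by (intro sum.cong) (auto simp: power2_eq_square less_le)
    then show "second_moment \<pi> (u 0) \<le> 1 / min_mass \<pi>" using inverse_mass[of x] by simp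
  qed
  have var_v: "variance_of \<pi> (v T) \<le> \<epsilon>"
    unfolding T_def
  proof (rule variance_decay[OF _ v_mean _ _ \<epsilon>])
    show "0 \<le> v t z" if "0 \<le> t" for t z
      using heat_kernel_nonneg[OF that] mass_nonneg by (simp add: v_def)
    show "((\<lambda>t. second_moment \<pi> (v t)) has_real_derivative - 2 * dirichlet_form K \<pi> (v t)) (at t)" for t
    proof (rule second_moment_deriv)
      show "((\<lambda>t. v t z) has_real_derivative (\<Sum>w\<in>UNIV. K z w * heat_kernel K t w y) / \<pi> y - v t z) (at t)" for z
        unfolding v_def diff_divide_distrib[symmetric]
        by (intro DERIV_cdivide heat_kernel_backward_equation)
      show "(\<Sum>z\<in>UNIV. \<pi> z * (v t z * ((\<Sum>w\<in>UNIV. K z w * heat_kernel K t w y) / \<pi> y)))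
          = (\<Sum>z\<in>UNIV. \<Sum>w\<in>UNIV. \<pi> z * K z w * (v t z * v t w))"
        by (simp add: v_def sum_distrib_left sum_divide_distrib mult_ac)
    qed
    have "second_moment \<pi> (v 0) = (\<Sum>z\<in>UNIV. if y = z then 1 / \<pi> z else 0)"
      unfolding expect_def v_def heat_kernel_0 using mass_pos
      by (intro sum.cong) (auto simp: power2_eq_square less_le)
    then show "second_moment \<pi> (v 0) \<le> 1 / min_mass \<pi>" using inverse_mass[of y] by simp
  qed
  have factorization: "(heat_kernel K (2 * T) x y - \<pi> y) / \<pi> y = expect \<pi> (\<lambda>z. u T z * v T z) - 1"
  proof -
    have "expect \<pi> (\<lambda>z. u T z * v T z) = (\<Sum>z\<in>UNIV. heat_kernel K T x z * heat_kernel K T z y) / \<pi> y"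
      by (simp add: expect_def mult.assoc[symmetric] mass_u v_def sum_divide_distrib)
    also have "\<dots> = heat_kernel K (2 * T) x y / \<pi> y"
      using heat_kernel_semigroup[of T T x y] by simp
    finally show ?thesis using mass_pos[of y] by (simp add: diff_divide_distrib)
  qed
  show ?thesis
    unfolding factorization
    by (rule order_trans[OF mean_one_covariance_bound[OF u_mean v_mean]]) (use var_u var_v in simp)
qed

lemma heat_kernel_le_1: "0 \<le> t \<Longrightarrow> heat_kernel K t x y \<le> 1"
  using member_le_sum[of y UNIV "heat_kernel K t x"] heat_kernel_nonneg heat_kernel_row_sum[of t x] by simp

text \<open>
  The density \<open>H\<^sub>t(x,y) / \<pi>(y)\<close> lies between 0 and \<open>1 / \<pi>\<^sub>*\<close> at every time.
\<close>

lemma heat_kernel_trivial_bound: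
  assumes "0 \<le> t" "1 / min_mass \<pi> \<le> \<epsilon>"
  shows "\<bar>(heat_kernel K t x y - \<pi> y) / \<pi> y\<bar> \<le> \<epsilon>"
proof -
  have "1 \<le> 1 / \<pi> y"
    using member_le_sum[of y UNIV \<pi>] mass_nonneg mass_total mass_pos[of y] by simp
  moreover have "1 / \<pi> y \<le> 1 / min_mass \<pi>"
    using min_mass_le[of y] min_mass_pos by (intro divide_left_mono) (auto simp: mass_pos)
  moreover have "heat_kernel K t x y / \<pi> y \<le> 1 / \<pi> y" "0 \<le> heat_kernel K t x y / \<pi> y"
    using heat_kernel_le_1[OF assms(1)] heat_kernel_nonneg[OF assms(1)] mass_pos[of y]
    by (auto intro: divide_right_mono)
  moreover have "(heat_kernel K t x y - \<pi> y) / \<pi> y = heat_kernel K t x y / \<pi> y - 1"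
    using mass_pos[of y] by (simp add: diff_divide_distrib)
  ultimately show ?thesis using assms(2) by linarith
qed

lemma mixing_time_le:
  assumes "0 < t" "\<And>x y. \<bar>(heat_kernel K t x y - \<pi> y) / \<pi> y\<bar> \<le> \<epsilon>"
  shows "mixing_time_Linf K \<pi> \<epsilon> \<le> ereal t"
  unfolding mixing_time_Linf_def using assms
  by (intro Inf_lower imageI) (auto intro!: cSUP_least)

end

theorem corollary1p1:
  fixes K :: "'a::finite \<Rightarrow> 'a \<Rightarrow> real" and \<pi> :: "'a \<Rightarrow> real" and \<epsilon> :: real
  assumes "CARD('a) \<ge> 2"
    and "markov_kernel K"
    and "irreducible_kernel K"
    and "prob_mass \<pi>"
    and "invariant K \<pi>"
    and "\<epsilon> > 0"
  shows "mixing_time_Linf K \<pi> \<epsilon> \<le>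
    ereal (integral {4 * min_mass \<pi>..4 / \<epsilon>}
      (\<lambda>v. 4 / (v * (trunc_conductance_profile K \<pi> v)\<^sup>2)))"
proof -
  interpret ergodic_chain K \<pi>
    using assms by unfold_locales
  show ?thesis
  proof (cases "\<epsilon> < 1 / min_mass \<pi>")
    case True
    define T where "T = integral {4 * min_mass \<pi>..4 / \<epsilon>} (\<lambda>v. 1 / (v * ((\<Phi>\<^sub>* v)\<^sup>2 / 2)))"
    have "0 < T" unfolding T_def using assms(6) True min_mass_pos
      by (intro integral_profile_pos) (auto simp: field_simps)
    then have "mixing_time_Linf K \<pi> \<epsilon> \<le> ereal (2 * T)"
      using heat_kernel_density_bound[OF assms(6) True] unfolding T_def
      by (intro mixing_time_le) auto
    also have "2 * T = integral {4 * min_mass \<pi>..4 / \<epsilon>} (\<lambda>v. 2 * (1 / (v * ((\<Phi>\<^sub>* v)\<^sup>2 / 2))))"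
      unfolding T_def by (rule integral_mult_right[symmetric])
    finally show ?thesis by simp
  next
    case False
    then have "4 / \<epsilon> \<le> 4 * min_mass \<pi>"
      using assms(6) min_mass_pos by (simp add: field_simps)
    then have "integral {4 * min_mass \<pi>..4 / \<epsilon>} (\<lambda>v. 4 / (v * (\<Phi>\<^sub>* v)\<^sup>2)) = 0"
      by (cases "4 / \<epsilon> = 4 * min_mass \<pi>") auto
    moreover have "mixing_time_Linf K \<pi> \<epsilon> \<le> ereal 0"
    proof (rule ereal_le_epsilon2)
      show "mixing_time_Linf K \<pi> \<epsilon> \<le> ereal 0 + ereal e" if "0 < e" for e
        using that False by (auto intro!: mixing_time_le heat_kernel_trivial_bound)
    qed
    ultimately show ?thesis by simp
  qed
qed

end
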